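(* Let $(X,r)$ be a right-non-degenerate (RND) solution, and let $k$ be a reflection for $(X,r)$. Then the structure shelf operations $\triangleleft$ of $r$ and $\triangleleft_k$ of $r^{(k)}$ coincide. If moreover $k$ and $r$ are both invertible, then $$k(b\triangleright_k a)=k(a)\triangleleft k(b)\qquad\text{for all } a,b\in X,$$ where $\triangleright_k$ is the left structure shelf operation of $r^{(k)}$.
   Context: Products of maps denote composition, the rightmost map being applied first. For a map $\phi\colon X^m\to X^m$, $\phi_i$ denotes the map on $X^n$ that applies $\phi$ to the $m$ consecutive coordinates starting at position $i$ and is the identity on the others. A solution $(X,r)$ is a set $X$ with a map $r\colon X\times X\to X\times X$ (not assumed bijective) satisfying the Yang–Baxter equation $r_1r_2r_1=r_2r_1r_2$ on $X^3$; write $r(a,b)=(\lambda_a(b),\rho_b(a))$. It is right-non-degenerate (RND) if all maps $\rho_b\colon X\to X$ are bijective, and left-non-degenerate (LND) if all maps $\lambda_a\colon X\to X$ are bijective. A reflection for $(X,r)$ is a map $k\colon X\to X$ with $r k_2 r k_2=k_2 r k_2 r$ on $X^2$. For an RND solution and a reflection $k$, the $k$-derived solution is the map $r^{(k)}\colon X\times X\to X\times X$, $r^{(k)}(a,b)=(b',a')$, where $a'=\rho_b\rho_{k(b)}^{-1}(a)$ and $b'=\rho_{k(a')}\lambda_{\rho_{k(b)}^{-1}(a)}(b)$. It is again an RND solution. The structure shelf operation of an RND solution $r$ is $a\triangleleft b=\rho_b\lambda_{\rho_a^{-1}(b)}(a)$. The left structure shelf operation of an LND solution is $b\triangleright a=\lambda_b\rho_{\lambda_a^{-1}(b)}(a)$.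 The operations $\triangleleft_k$, $\triangleright_k$ are given by the same formulas with the components $\lambda,\rho$ of $r$ replaced by those of $r^{(k)}$. When $k$ and $r$ are both invertible, $r^{(k)}$ is automatically LND, so $\triangleright_k$ is defined. *)

theory Defs
  imports Main
begin

text \<open>
  The underlying set \<open>X\<close> is the type \<open>'a\<close>, and \<open>X\<^sup>3\<close> is \<open>'a \<times> 'a \<times> 'a\<close>,
  nested to the right.
\<close>

definition on12 :: "('a \<times> 'a \<Rightarrow> 'a \<times> 'a) \<Rightarrow> 'a \<times> 'a \<times> 'a \<Rightarrow> 'a \<times> 'a \<times> 'a" where
  "on12 r = (\<lambda>(a, b, c). case r (a, b) of (a', b') \<Rightarrow> (a', b', c))"

definition on23 :: "('a \<times> 'a \<Rightarrow> 'a \<times> 'a) \<Rightarrow> 'a \<times> 'a \<times> 'a \<Rightarrow> 'a \<times> 'a \<times> 'a" where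
  "on23 r = (\<lambda>(a, b, c). (a, r (b, c)))"

definition on2 :: "('a \<Rightarrow> 'a) \<Rightarrow> 'a \<times> 'a \<Rightarrow> 'a \<times> 'a" where
  "on2 k = (\<lambda>(a, b). (a, k b))"

definition solution :: "('a \<times> 'a \<Rightarrow> 'a \<times> 'a) \<Rightarrow> bool" where
  "solution r \<longleftrightarrow> on12 r \<circ> on23 r \<circ> on12 r = on23 r \<circ> on12 r \<circ> on23 r"

text \<open>\<open>r (a, b) = (lam r a b, rho r b a)\<close>; the subscript is the first argument after \<open>r\<close>.\<close>

definition lam :: "('a \<times> 'a \<Rightarrow> 'a \<times> 'a) \<Rightarrow> 'a \<Rightarrow> 'a \<Rightarrow> 'a" where
  "lam r a b = fst (r (a, b))"

definition rho :: "('a \<times> 'a \<Rightarrow> 'a \<times> 'a) \<Rightarrow> 'a \<Rightarrow> 'a \<Rightarrow> 'a" where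
  "rho r b a = snd (r (a, b))"

definition right_nondegenerate :: "('a \<times> 'a \<Rightarrow> 'a \<times> 'a) \<Rightarrow> bool" where
  "right_nondegenerate r \<longleftrightarrow> (\<forall>b. bij (rho r b))"

definition left_nondegenerate :: "('a \<times> 'a \<Rightarrow> 'a \<times> 'a) \<Rightarrow> bool" where
  "left_nondegenerate r \<longleftrightarrow> (\<forall>a. bij (lam r a))"

definition reflection :: "('a \<times> 'a \<Rightarrow> 'a \<times> 'a) \<Rightarrow> ('a \<Rightarrow> 'a) \<Rightarrow> bool" where
  "reflection r k \<longleftrightarrow> r \<circ> on2 k \<circ> r \<circ> on2 k = on2 k \<circ> r \<circ> on2 k \<circ> r"

text \<open>
  The next three operations are meaningful only under the appropriate non-degeneracy,
  where every \<open>inv\<close> is applied to a bijection; the two lemmas at the end provide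
  this for \<open>derived r k\<close>.
\<close>

definition derived ::
  "('a \<times> 'a \<Rightarrow> 'a \<times> 'a) \<Rightarrow> ('a \<Rightarrow> 'a) \<Rightarrow> 'a \<times> 'a \<Rightarrow> 'a \<times> 'a" where
  "derived r k = (\<lambda>(a, b).
     let c = inv (rho r (k b)) a;
         a' = rho r b c;
         b' = rho r (k a') (lam r c b)
     in (b', a'))"

definition shelf :: "('a \<times> 'a \<Rightarrow> 'a \<times> 'a) \<Rightarrow> 'a \<Rightarrow> 'a \<Rightarrow> 'a" where
  "shelf r a b = rho r b (lam r (inv (rho r a) b) a)"

text \<open>\<open>left_shelf r b a\<close> is \<open>b \<triangleright> a\<close>.\<close>

definition left_shelf :: "('a \<times> 'a \<Rightarrow> 'a \<times> 'a) \<Rightarrow> 'a \<Rightarrow> 'a \<Rightarrow> 'a" where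
  "left_shelf r b a = lam r b (rho r (inv (lam r a) b) a)"

lemma right_nondegenerate_derived:
  assumes "right_nondegenerate r"
  shows "right_nondegenerate (derived r k)"
proof -
  have "rho (derived r k) b = rho r b \<circ> inv (rho r (k b))" for b
    by (auto simp: derived_def rho_def Let_def)
  then show ?thesis
    using assms by (simp add: right_nondegenerate_def bij_comp bij_imp_bij_inv)
qed

lemma left_nondegenerate_derived:
  assumes rnd: "right_nondegenerate r" and refl: "reflection r k"
    and k: "bij k" and r: "bij r"
  shows "left_nondegenerate (derived r k)"
  unfolding left_nondegenerate_def
proof
  fix a
  have rho: "bij (rho r x)" for x
    using rnd by (simp add: right_nondegenerate_def)
  have r_eq: "r (x, y) = (lam r x y, rho r y x)" for x y
    by (simp add: lam_def rho_def)
  define h where "h b = rho r (k a) (lam r (inv (rho r (k b)) a) (k b))" for b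
  have k_lam: "k (lam (derived r k) a b) = h b" for b
  proof -
    define c where "c = inv (rho r (k b)) a"
    have a: "rho r (k b) c = a"
      using rho by (simp add: c_def bij_is_surj surj_f_inv_f)
    have "(r \<circ> on2 k \<circ> r \<circ> on2 k) (c, b) = (on2 k \<circ> r \<circ> on2 k \<circ> r) (c, b)"
      using refl by (simp add: reflection_def)
    then show ?thesis
      by (simp add: on2_def r_eq a h_def c_def[symmetric])
        (simp add: lam_def derived_def Let_def c_def[symmetric])
  qed
  have c_r: "r (inv (rho r (k b)) a, k b) = (lam r (inv (rho r (k b)) a) (k b), a)" for b
    using rho by (simp add: r_eq bij_is_surj surj_f_inv_f)
  have "inj (lam (derived r k) a)"
  proof (rule injI)
    fix x y assume "lam (derived r k) a x = lam (derived r k) a y"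
    then have "h x = h y" by (metis k_lam)
    then have "lam r (inv (rho r (k x)) a) (k x) = lam r (inv (rho r (k y)) a) (k y)"
      using rho by (simp add: h_def bij_is_inj inj_eq)
    then have "(inv (rho r (k x)) a, k x) = (inv (rho r (k y)) a, k y)"
      using c_r r by (metis bij_is_inj injD)
    then show "x = y" using k by (simp add: bij_is_inj inj_eq)
  qed
  moreover have "\<exists>x. lam (derived r k) a x = y" for y
  proof -
    obtain d where d: "rho r (k a) d = k y"
      using rho by (metis bij_pointE)
    obtain c x where x: "r (c, k x) = (d, a)"
      using r k by (metis bij_pointE surj_pair)
    have "inv (rho r (k x)) a = c"
      using x rho by (metis bij_inv_eq_iff rho_def snd_conv)
    then have "h x = k y" using x d by (simp add: h_def lam_def)
    then show ?thesis using k k_lam by (metis bij_is_inj injD)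
  qed
  ultimately show "bij (lam (derived r k) a)"
    by (metis bijI surjI)
qed

end

theory Submission
  imports Defs
begin

text \<open>
  Write \<open>\<lambda>\<close> and \<open>\<rho>\<close> for the components of \<open>r\<close>. Each shelf operation reads off a component of the
  square of its solution: if \<open>r (c, a) = (x, b)\<close>, then \<open>shelf r a b\<close> is the second component of
  \<open>r (r (c, a))\<close>, and dually \<open>left_shelf r x c\<close> is its first component. Right
  non-degeneracy makes every pair have the form \<open>(\<rho>\<^bsub>k x\<^esub> c, x)\<close>, and in this
  parametrisation the derived solution loses its inverses:
  \<open>derived r k (\<rho>\<^bsub>k x\<^esub> c, x) = (\<rho>\<^bsub>k e\<^esub> (\<lambda>\<^bsub>c\<^esub> x), e)\<close> with \<open>e = \<rho>\<^bsub>x\<^esub> c\<close>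
  (lemmas \<open>lam_derived\<close> and \<open>rho_derived\<close>).

  Squaring the derived solution, its second component is computed by applying
  \<open>\<rho>\<^bsub>e\<^esub> \<circ> inv \<rho>\<^bsub>k e\<^esub>\<close> to \<open>\<rho>\<^bsub>k e\<^esub> (\<lambda>\<^bsub>c\<^esub> x)\<close>; the twists by \<open>k e\<close> cancel and the second component
  of the square of \<open>r\<close> at \<open>(c, x)\<close> remains. Hence the two shelves coincide.

  For the left shelf, \<open>a = \<rho>\<^bsub>k x\<^esub> c\<close> and \<open>b = \<rho>\<^bsub>k e\<^esub> (\<lambda>\<^bsub>c\<^esub> x)\<close>. The second component of the
  reflection equation moves \<open>k\<close> inside the first component of the derived solution. Applied at
  \<open>(\<lambda>\<^bsub>c\<^esub> x, e)\<close> it turns \<open>k (left_shelf (derived r k) b a)\<close> into \<open>\<rho>\<^bsub>k b\<^esub>\<close> of the left side of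
  \<open>\<lambda>\<^bsub>\<lambda>\<^bsub>c\<^esub> x\<^esub> (k e) = \<lambda>\<^bsub>\<lambda>\<^bsub>c\<^esub> (k x)\<^esub> (k a)\<close>; applied at \<open>(c, x)\<close> it gives
  \<open>k b = \<rho>\<^bsub>k a\<^esub> (\<lambda>\<^bsub>c\<^esub> (k x))\<close>, so that \<open>shelf r (k a) (k b)\<close> is \<open>\<rho>\<^bsub>k b\<^esub>\<close> of the right side. The
  displayed equality is the first component of the reflection equation at \<open>(c, x)\<close>.
\<close>

lemma eq_lam_rho: "r (a, b) = (lam r a b, rho r b a)"
  by (simp add: lam_def rho_def)

lemma reflection_components:
  assumes "reflection r k"
  shows reflection_fst:
      "lam r (lam r c (k x)) (k (rho r (k x) c)) = lam r (lam r c x) (k (rho r x c))"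
    and reflection_snd:
      "rho r (k (rho r (k x) c)) (lam r c (k x)) = k (rho r (k (rho r x c)) (lam r c x))"
proof -
  have "(r \<circ> on2 k \<circ> r \<circ> on2 k) (c, x) = (on2 k \<circ> r \<circ> on2 k \<circ> r) (c, x)"
    using assms by (simp add: reflection_def)
  then show "lam r (lam r c (k x)) (k (rho r (k x) c)) = lam r (lam r c x) (k (rho r x c))"
    and "rho r (k (rho r (k x) c)) (lam r c (k x)) = k (rho r (k (rho r x c)) (lam r c x))"
    by (simp_all add: on2_def eq_lam_rho[of r])
qed

lemma inv_rho_rho:
  assumes "right_nondegenerate r"
  shows "inv (rho r b) (rho r b c) = c"
  using assms by (simp add: right_nondegenerate_def bij_is_inj)

lemma right_nondegenerateE:
  assumes "right_nondegenerate r"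
  obtains c where "a = rho r b c"
  using assms by (metis right_nondegenerate_def bij_pointE)

text \<open>
  Evaluating \<open>derived r k\<close> at \<open>(rho r (k x) c, x)\<close> makes the inverse in its definition equal to
  \<open>c\<close>. The pair \<open>(c, x)\<close> is therefore the coordinate in which \<open>r\<close> and its derived solution are
  compared.
\<close>

lemma rho_derived:
  assumes "right_nondegenerate r"
  shows "rho (derived r k) x (rho r (k x) c) = rho r x c"
  by (simp add: rho_def[of "derived r k"])
    (simp add: derived_def Let_def inv_rho_rho[OF assms])

lemma lam_derived:
  assumes "right_nondegenerate r"
  shows "lam (derived r k) (rho r (k x) c) x = rho r (k (rho r x c)) (lam r c x)"
  by (simp add: lam_def[of "derived r k"])
    (simp add: derived_def Let_def inv_rho_rho[OF assms])

text \<open>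
  The shelf operations without inverses: \<open>shelf\<close> and \<open>left_shelf\<close> give the second and the first
  component of \<open>r \<circ> r\<close>.
\<close>

lemma shelf_rho:
  assumes "right_nondegenerate r"
  shows "shelf r a (rho r a c) = rho r (rho r a c) (lam r c a)"
  using inv_rho_rho[OF assms] by (simp add: shelf_def)

lemma left_shelf_lam:
  assumes "left_nondegenerate r"
  shows "left_shelf r (lam r a x) a = lam r (lam r a x) (rho r x a)"
  using assms by (simp add: left_shelf_def left_nondegenerate_def bij_is_inj)

lemma shelf_derived:
  assumes rnd: "right_nondegenerate r"
  shows "shelf (derived r k) = shelf r"
proof (intro ext)
  fix a b
  obtain c where b: "b = rho r a c"
    using rnd by (rule right_nondegenerateE)
  have b': "b = rho (derived r k) a (rho r (k a) c)"
    by (simp add: b rho_derived[OF rnd])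
  have "shelf (derived r k) a b = rho (derived r k) b (lam (derived r k) (rho r (k a) c) a)"
    unfolding b' by (rule shelf_rho[OF right_nondegenerate_derived[OF rnd]])
  also have "\<dots> = rho (derived r k) b (rho r (k b) (lam r c a))"
    by (simp add: lam_derived[OF rnd] b)
  also have "\<dots> = rho r b (lam r c a)"
    by (rule rho_derived[OF rnd])
  also have "\<dots> = shelf r a b"
    by (simp add: b shelf_rho[OF rnd])
  finally show "shelf (derived r k) a b = shelf r a b" .
qed

lemma reflection_left_shelf_derived:
  assumes rnd: "right_nondegenerate r" and refl: "reflection r k"
    and lnd: "left_nondegenerate (derived r k)"
  shows "k (left_shelf (derived r k) b a) = shelf r (k a) (k b)"
proof -
  obtain x where x: "b = lam (derived r k) a x"
    using lnd by (metis left_nondegenerate_def bij_pointE)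
  obtain c where a: "a = rho r (k x) c"
    using rnd by (rule right_nondegenerateE)
  \<comment> \<open>\<open>derived r k\<close> sends \<open>(a, x)\<close> to \<open>(b, e)\<close>, so the left shelf value is its first component
    at \<open>(b, e)\<close>; the coordinate of that pair is \<open>(lam r c x, e)\<close>.\<close>
  define e where "e = rho r x c"
  have b: "b = rho r (k e) (lam r c x)"
    by (simp add: x a e_def lam_derived[OF rnd])
  have kb: "k b = rho r (k a) (lam r c (k x))"
    by (simp add: a b e_def reflection_snd[OF refl])
  have "left_shelf (derived r k) b a = lam (derived r k) b (rho (derived r k) x a)"
    unfolding x by (rule left_shelf_lam[OF lnd])
  also have "\<dots> = lam (derived r k) (rho r (k e) (lam r c x)) e"
    by (simp add: a e_def rho_derived[OF rnd] b[unfolded a e_def])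
  also have "\<dots> = rho r (k (rho r e (lam r c x))) (lam r (lam r c x) e)"
    by (rule lam_derived[OF rnd])
  finally have "k (left_shelf (derived r k) b a) = rho r (k b) (lam r (lam r c x) (k e))"
    by (simp add: b reflection_snd[OF refl])
  also have "\<dots> = rho r (k b) (lam r (lam r c (k x)) (k a))"
    by (simp add: a e_def reflection_fst[OF refl])
  also have "\<dots> = shelf r (k a) (k b)"
    by (simp add: kb shelf_rho[OF rnd])
  finally show ?thesis .
qed

theorem theorem1p10:
  fixes r :: "'a \<times> 'a \<Rightarrow> 'a \<times> 'a" and k :: "'a \<Rightarrow> 'a"
  assumes "solution r"
    and "right_nondegenerate r"
    and "reflection r k"
  shows "shelf (derived r k) = shelf r \<and>
         (bij k \<and> bij r \<longrightarrow>
            (\<forall>a b. k (left_shelf (derived r k) b a) = shelf r (k a) (k b)))"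
proof (intro conjI impI allI)
  show "shelf (derived r k) = shelf r"
    by (rule shelf_derived) fact
next
  fix a b
  assume "bij k \<and> bij r"
  then have "left_nondegenerate (derived r k)"
    using assms by (simp add: left_nondegenerate_derived)
  with assms show "k (left_shelf (derived r k) b a) = shelf r (k a) (k b)"
    by (simp add: reflection_left_shelf_derived)
qed

end
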